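(* Let $K$ be an irreducible Markov kernel on a finite state space $\mathcal{X}$ with invariant probability measure $\pi$. Assume that $K(x,x)\ge\alpha>0$ for all $x\in\mathcal X$. Then for $\epsilon>0$, the $L^\infty$ mixing time for the discrete-time chain $K_n$ satisfies $$\tau_{\infty}(\epsilon) \leq 2\left\lceil \int_{4\pi_*}^{4/\epsilon} \frac{dv}{\alpha\, v\, \Lambda(v)}\right\rceil.$$
   Context: $K$ is not assumed reversible. $K_n$ denotes the kernel of $K^n$ ($n$-step transition probabilities), $\pi$ is the unique invariant probability measure of $K$, and $\pi_*=\min_x\pi(x)>0$. The discrete-time $L^\infty$ mixing time is $$\tau_\infty(\epsilon)=\inf\Big\{n\in\{0,1,2,\dots\}:\ \sup_{x,y\in\mathcal X}\Big|\frac{K_n(x,y)}{\pi(y)}-1\Big|\le\epsilon\Big\}.$$ Dirichlet form: $\mathcal{E}(f,g)=\langle (I-K)f,g\rangle_\pi=\sum_{x}((I-K)f)(x)g(x)\pi(x)$ for $f,g:\mathcal X\to\mathbb R$; $\mathrm{Var}(f)$ is the variance with respect to $\pi$. For non-empty $S\subset\mathcal X$, $$\lambda(S)=\inf_{f\in c_0^+(S)}\frac{\mathcal E(f,f)}{\mathrm{Var}(f)},\qquad c_0^+(S)=\{f:\mathcal X\to\mathbb R:\ \mathrm{supp}(f)\subset S,\ f\ge0,\ f\ne \text{constant}\}.$$ The spectral profile (of $K$) is $\Lambda:[\pi_*,\infty)\to\mathbb R$, $\Lambda(r)=\inf_{\pi_*\le\pi(S)\le r}\lambda(S)$.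
   Formalization: When ε > 1/π_*, so that the upper limit 4/ε is below 4π_*, the integral is taken to be 0; read as an oriented (negative) integral, the bound could be negative and thus false (two points, K ≡ 1/2, α = 1/2, ε = 8), or Λ undefined. *)

theory Defs
  imports "HOL-Probability.Probability"
begin

primrec kernel_power :: "('a \<Rightarrow> 'a pmf) \<Rightarrow> nat \<Rightarrow> 'a \<Rightarrow> 'a pmf" where
  "kernel_power K 0 x = return_pmf x"
| "kernel_power K (Suc n) x = bind_pmf (K x) (kernel_power K n)"

definition irreducible_kernel :: "('a \<Rightarrow> 'a pmf) \<Rightarrow> bool" where
  "irreducible_kernel K \<longleftrightarrow> (\<forall>x y. \<exists>n. pmf (kernel_power K n x) y > 0)"

definition invariant_pmf :: "('a \<Rightarrow> 'a pmf) \<Rightarrow> 'a pmf \<Rightarrow> bool" where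
  "invariant_pmf K \<pi> \<longleftrightarrow> bind_pmf \<pi> K = \<pi>"

definition min_prob :: "'a::finite pmf \<Rightarrow> real" where
  "min_prob \<pi> = Min (range (pmf \<pi>))"

text \<open>The infimum is taken in \<^typ>\<open>enat\<close>, so that it is infinite if the level
  \<open>\<epsilon>\<close> is never reached (the infimum of the empty set of naturals would be 0).\<close>

definition mixing_time_Linf :: "('a::finite \<Rightarrow> 'a pmf) \<Rightarrow> 'a pmf \<Rightarrow> real \<Rightarrow> enat" where
  "mixing_time_Linf K \<pi> \<epsilon> =
     (INF n\<in>{n. (SUP (x, y)\<in>UNIV. \<bar>pmf (kernel_power K n x) y / pmf \<pi> y - 1\<bar>) \<le> \<epsilon>}. enat n)"

definition dirichlet_form ::
    "('a::finite \<Rightarrow> 'a pmf) \<Rightarrow> 'a pmf \<Rightarrow> ('a \<Rightarrow> real) \<Rightarrow> ('a \<Rightarrow> real) \<Rightarrow> real" where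
  "dirichlet_form K \<pi> f g =
     (\<Sum>x\<in>UNIV. (f x - (\<Sum>y\<in>UNIV. pmf (K x) y * f y)) * g x * pmf \<pi> x)"

definition c0_plus :: "'a set \<Rightarrow> ('a \<Rightarrow> real) set" where
  "c0_plus S = {f. {x. f x \<noteq> 0} \<subseteq> S \<and> (\<forall>x. f x \<ge> 0) \<and> \<not> f constant_on UNIV}"

text \<open>The infima are taken in \<^typ>\<open>ereal\<close>: on a one-point state space every function is
  constant, and the infimum over the empty set of test functions is infinite. On larger state
  spaces the values are real.\<close>

definition set_eigenvalue :: "('a::finite \<Rightarrow> 'a pmf) \<Rightarrow> 'a pmf \<Rightarrow> 'a set \<Rightarrow> ereal" where
  "set_eigenvalue K \<pi> S =
     (INF f\<in>c0_plus S. ereal (dirichlet_form K \<pi> f f / measure_pmf.variance \<pi> f))"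

definition spectral_profile :: "('a::finite \<Rightarrow> 'a pmf) \<Rightarrow> 'a pmf \<Rightarrow> real \<Rightarrow> ereal" where
  "spectral_profile K \<pi> r =
     (INF S\<in>{S. min_prob \<pi> \<le> measure_pmf.prob \<pi> S \<and> measure_pmf.prob \<pi> S \<le> r}.
        set_eigenvalue K \<pi> S)"

definition ennreal_ceiling :: "ennreal \<Rightarrow> enat" where
  "ennreal_ceiling x = (if x = \<infinity> then \<infinity> else enat (nat \<lceil>enn2real x\<rceil>))"

text \<open>The integral of the nonnegative function \<open>1 / (\<alpha> v \<Lambda>(v))\<close> from \<open>a\<close> to \<open>b\<close>, with
  \<open>1 / \<infinity> = 0\<close> and \<open>1 / 0 = \<infinity>\<close> for the values of \<open>\<Lambda>\<close>. It is an integral over the set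
  \<open>{a..b}\<close>, hence 0, not a negative oriented integral, if \<open>b < a\<close>.\<close>

definition profile_integral ::
    "('a::finite \<Rightarrow> 'a pmf) \<Rightarrow> 'a pmf \<Rightarrow> real \<Rightarrow> real \<Rightarrow> real \<Rightarrow> ennreal" where
  "profile_integral K \<pi> \<alpha> a b =
     (\<integral>\<^sup>+v\<in>{a..b}. e2ennreal (1 / (ereal (\<alpha> * v) * spectral_profile K \<pi> v)) \<partial>lborel)"

end

theory Submission imports Defs begin

text \<open>
  Fix a target state \<open>y\<close>. The functions \<open>h\<^sub>n(z) = K\<^sub>n(z, y) / \<pi>(y)\<close> are nonnegative, have mean 1
  under \<open>\<pi>\<close> and satisfy \<open>h\<^sub>n\<^sub>+\<^sub>1 = K h\<^sub>n\<close>. Holding with probability at least \<open>\<alpha>\<close> gives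
  \<open>Var(K f) \<le> Var(f) - 2 \<alpha> \<E>(f, f)\<close> (\<open>variance_kernel_operator_le\<close>): the variance lost in one step is
  the average over \<open>x\<close> of the variance of \<open>f\<close> under \<open>K(x, \<cdot>)\<close>, which is at least \<open>\<alpha>\<close> times the
  mean-square increment of \<open>f\<close> from \<open>x\<close>.

  The spectral profile turns this into a recursion for the variance alone. If \<open>f \<ge> 0\<close> has mean 1 and
  variance \<open>V\<close>, then cutting \<open>f\<close> off below the level \<open>V/4\<close> keeps at least half of the variance, does
  not increase the Dirichlet form, and leaves a function supported on a set of mass at most \<open>4/V\<close>.
  Hence \<open>2 \<E>(f, f) / V \<ge> \<Lambda>(4/V)\<close> (\<open>spectral_profile_le_dirichlet_form\<close>), and \<open>V\<^sub>n = Var(h\<^sub>n)\<close> satisfies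
  \<open>V\<^sub>n\<^sub>+\<^sub>1 \<le> V\<^sub>n (1 - \<alpha> \<Lambda>(4/V\<^sub>n))\<close>. In the variable \<open>v = 4/V\<close> the integral of \<open>1 / (\<alpha> v \<Lambda>(v))\<close> is a
  clock for this recursion: because \<open>\<Lambda>\<close> is nonincreasing, each step of the chain advances it by at
  least 1 (\<open>profile_integral_gt_steps\<close>). It starts at \<open>4/V\<^sub>0 \<ge> 4 \<pi>\<^sub>*\<close>, so after \<open>n\<close> steps, with \<open>n\<close> at
  least the integral from \<open>4 \<pi>\<^sub>*\<close> to \<open>4/\<epsilon>\<close>, the variance is at most \<open>\<epsilon>\<close>
  (\<open>kernel_power_mean_square_le\<close>).

  The time reversal of \<open>K\<close> has the same holding probabilities and the same quadratic form \<open>\<E>(f, f)\<close>,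
  so the same bound holds for it. Splitting a path of length \<open>2n\<close> in the middle writes
  \<open>K\<^sub>2\<^sub>n(x, y) / \<pi>(y) - 1\<close> as the inner product of the centred densities for the reversed and the
  original chain, and the Cauchy--Schwarz inequality bounds it by \<open>\<epsilon>\<close>
  (\<open>kernel_power_uniform_le\<close>). The two halves of the path account for the factor 2 in front of the
  ceiling.
\<close>

section \<open>Finite sums for a kernel with invariant measure\<close>

definition kernel_operator :: "('a::finite \<Rightarrow> 'a pmf) \<Rightarrow> ('a \<Rightarrow> real) \<Rightarrow> 'a \<Rightarrow> real" where
  "kernel_operator K f x = (\<Sum>y\<in>UNIV. pmf (K x) y * f y)"

lemma sum_pmf_UNIV [simp]:
  fixes p :: "'a::finite pmf"
  shows "(\<Sum>y\<in>UNIV. pmf p y) = 1"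
  by (rule sum_pmf_eq_1) auto

lemma expectation_finite:
  fixes p :: "'a::finite pmf" and f :: "'a \<Rightarrow> real"
  shows "measure_pmf.expectation p f = (\<Sum>x\<in>UNIV. pmf p x * f x)"
  by (subst integral_measure_pmf_real[of UNIV]) (auto simp: mult.commute)

lemma prob_finite:
  fixes p :: "'a::finite pmf"
  shows "measure_pmf.prob p S = (\<Sum>x\<in>S. pmf p x)"
  by (simp add: measure_measure_pmf_finite)

lemma sum_centred_square:
  fixes p :: "'a::finite pmf" and f :: "'a \<Rightarrow> real"
  shows "(\<Sum>x\<in>UNIV. pmf p x * (f x - c)\<^sup>2) =
    (\<Sum>x\<in>UNIV. pmf p x * (f x)\<^sup>2) - 2 * c * (\<Sum>x\<in>UNIV. pmf p x * f x) + c\<^sup>2"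
proof -
  have "(\<Sum>x\<in>UNIV. pmf p x * (f x - c)\<^sup>2) =
      (\<Sum>x\<in>UNIV. pmf p x * (f x)\<^sup>2 - 2 * c * (pmf p x * f x) + c\<^sup>2 * pmf p x)"
    by (intro sum.cong) (auto simp: power2_eq_square algebra_simps)
  also have "\<dots> = (\<Sum>x\<in>UNIV. pmf p x * (f x)\<^sup>2) - 2 * c * (\<Sum>x\<in>UNIV. pmf p x * f x)
      + c\<^sup>2 * (\<Sum>x\<in>UNIV. pmf p x)"
    by (simp add: sum.distrib sum_subtractf flip: sum_distrib_left)
  finally show ?thesis by simp
qed

lemma variance_finite:
  fixes p :: "'a::finite pmf" and f :: "'a \<Rightarrow> real"
  shows "measure_pmf.variance p f =
    (\<Sum>x\<in>UNIV. pmf p x * (f x)\<^sup>2) - (\<Sum>x\<in>UNIV. pmf p x * f x)\<^sup>2"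
  unfolding expectation_finite sum_centred_square by (simp add: power2_eq_square)

lemma invariant_pmf_sum:
  fixes K :: "'a::finite \<Rightarrow> 'a pmf"
  assumes "invariant_pmf K \<pi>"
  shows "(\<Sum>x\<in>UNIV. pmf \<pi> x * pmf (K x) y) = pmf \<pi> y"
proof -
  have "pmf \<pi> y = pmf (bind_pmf \<pi> K) y" using assms by (simp add: invariant_pmf_def)
  then show ?thesis by (simp add: pmf_bind expectation_finite)
qed

lemma invariant_pmf_sum_operator:
  fixes K :: "'a::finite \<Rightarrow> 'a pmf"
  assumes "invariant_pmf K \<pi>"
  shows "(\<Sum>x\<in>UNIV. pmf \<pi> x * kernel_operator K f x) = (\<Sum>y\<in>UNIV. pmf \<pi> y * f y)"
proof -
  have "(\<Sum>x\<in>UNIV. pmf \<pi> x * kernel_operator K f x) =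
      (\<Sum>y\<in>UNIV. \<Sum>x\<in>UNIV. pmf \<pi> x * (pmf (K x) y * f y))"
    unfolding kernel_operator_def sum_distrib_left by (rule sum.swap)
  also have "\<dots> = (\<Sum>y\<in>UNIV. (\<Sum>x\<in>UNIV. pmf \<pi> x * pmf (K x) y) * f y)"
    by (simp add: sum_distrib_right mult.assoc)
  finally show ?thesis by (simp add: invariant_pmf_sum[OF assms])
qed

text \<open>Only the diagonal \<open>\<E>(f, f)\<close> has this form when the chain is not reversible. The square terms
  combine because both marginals of \<open>\<pi>(x) K(x, y)\<close> are \<open>\<pi>\<close>. The formula gives positivity,
  contraction under truncation and invariance under time reversal.\<close>

lemma dirichlet_form_eq_sum_squares:
  fixes K :: "'a::finite \<Rightarrow> 'a pmf"
  assumes "invariant_pmf K \<pi>"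
  shows "dirichlet_form K \<pi> f f =
    (\<Sum>x\<in>UNIV. pmf \<pi> x * (\<Sum>y\<in>UNIV. pmf (K x) y * (f y - f x)\<^sup>2)) / 2"
proof -
  have "(\<Sum>x\<in>UNIV. pmf \<pi> x * (\<Sum>y\<in>UNIV. pmf (K x) y * (f y - f x)\<^sup>2)) =
      (\<Sum>x\<in>UNIV. pmf \<pi> x * kernel_operator K (\<lambda>y. (f y)\<^sup>2) x
        - 2 * (f x * pmf \<pi> x * kernel_operator K f x) + pmf \<pi> x * (f x)\<^sup>2)"
    unfolding sum_centred_square kernel_operator_def
    by (intro sum.cong) (auto simp: algebra_simps)
  also have "\<dots> = 2 * (\<Sum>x\<in>UNIV. pmf \<pi> x * (f x)\<^sup>2)
      - 2 * (\<Sum>x\<in>UNIV. f x * pmf \<pi> x * kernel_operator K f x)"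
    by (simp add: sum.distrib sum_subtractf sum_distrib_left invariant_pmf_sum_operator[OF assms])
  also have "\<dots> = 2 * dirichlet_form K \<pi> f f"
    unfolding dirichlet_form_def kernel_operator_def[symmetric] sum_distrib_left sum_subtractf[symmetric]
    by (intro sum.cong) (auto simp: power2_eq_square algebra_simps)
  finally show ?thesis by simp
qed

lemma dirichlet_form_nonneg:
  fixes K :: "'a::finite \<Rightarrow> 'a pmf"
  assumes "invariant_pmf K \<pi>"
  shows "0 \<le> dirichlet_form K \<pi> f f"
  unfolding dirichlet_form_eq_sum_squares[OF assms]
  by (intro divide_nonneg_nonneg sum_nonneg mult_nonneg_nonneg) auto

text \<open>The map \<open>t \<mapsto> max (t - c) 0\<close> is 1-Lipschitz, so every squared increment shrinks.\<close>

lemma dirichlet_form_truncation_le: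
  fixes K :: "'a::finite \<Rightarrow> 'a pmf"
  assumes "invariant_pmf K \<pi>"
  shows "dirichlet_form K \<pi> (\<lambda>x. max (f x - c) 0) (\<lambda>x. max (f x - c) 0) \<le> dirichlet_form K \<pi> f f"
proof -
  have "(max (f y - c) 0 - max (f x - c) 0)\<^sup>2 \<le> (f y - f x)\<^sup>2" for x y
    by (subst abs_le_square_iff[symmetric]) auto
  then show ?thesis
    unfolding dirichlet_form_eq_sum_squares[OF assms]
    by (intro divide_right_mono sum_mono mult_left_mono) auto
qed

section \<open>The spectral profile bounds the energy of a density\<close>

lemma spectral_profile_antimono:
  assumes "r \<le> s"
  shows "spectral_profile K \<pi> s \<le> spectral_profile K \<pi> r"
  unfolding spectral_profile_def using assms by (intro INF_superset_mono) auto

lemma spectral_profile_nonneg: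
  assumes "invariant_pmf K \<pi>"
  shows "0 \<le> spectral_profile K \<pi> r"
  unfolding spectral_profile_def set_eigenvalue_def
  by (intro INF_greatest)
    (auto intro!: divide_nonneg_nonneg dirichlet_form_nonneg[OF assms] integral_nonneg)

text \<open>As the state space has finitely many subsets, the profile is a minimum of finitely many functions of
  \<open>r\<close>, each of them infinite up to the mass of its subset and constant from there on.\<close>

lemma spectral_profile_measurable [measurable]:
  fixes K :: "'a::finite \<Rightarrow> 'a pmf"
  shows "spectral_profile K \<pi> \<in> borel_measurable borel"
proof -
  have "spectral_profile K \<pi> = (\<lambda>r. INF S\<in>UNIV.
      if min_prob \<pi> \<le> measure_pmf.prob \<pi> S \<and> measure_pmf.prob \<pi> S \<le> r
      then set_eigenvalue K \<pi> S else top)" (is "_ = ?F")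
  proof (rule ext, rule antisym)
    fix r
    show "spectral_profile K \<pi> r \<le> ?F r"
      unfolding spectral_profile_def by (intro INF_greatest) (auto intro: INF_lower)
    show "?F r \<le> spectral_profile K \<pi> r"
      unfolding spectral_profile_def
    proof (intro INF_greatest)
      fix S assume "S \<in> {S. min_prob \<pi> \<le> measure_pmf.prob \<pi> S \<and> measure_pmf.prob \<pi> S \<le> r}"
      then show "?F r \<le> set_eigenvalue K \<pi> S" by (intro INF_lower2[of S]) auto
    qed
  qed
  also have "\<dots> \<in> borel_measurable borel"
    by (rule borel_measurable_INF) (auto intro: countable_finite)
  finally show ?thesis .
qed

text \<open>The test function for the profile is the truncation \<open>g = max (f - c) 0\<close>. A lower level \<open>c\<close> keeps
  more of the variance of \<open>f\<close>, a higher one makes the support of \<open>g\<close> smaller. With \<open>m\<close> the mean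
  and \<open>v\<close> the variance of \<open>f\<close>, the loss of variance is at most \<open>2cm\<close> and, by Markov's inequality,
  the support has mass at most \<open>m/c\<close>; the choice \<open>c = v/(4m)\<close> loses half of the variance.\<close>

lemma spectral_profile_le_dirichlet_form:
  fixes K :: "'a::finite \<Rightarrow> 'a pmf" and f :: "'a \<Rightarrow> real"
  assumes inv: "invariant_pmf K \<pi>" and f0: "\<And>x. 0 \<le> f x"
    and var: "0 < measure_pmf.variance \<pi> f"
  shows "spectral_profile K \<pi> (4 * (measure_pmf.expectation \<pi> f)\<^sup>2 / measure_pmf.variance \<pi> f)
    \<le> ereal (2 * dirichlet_form K \<pi> f f / measure_pmf.variance \<pi> f)"
proof -
  define m where "m = (\<Sum>x\<in>UNIV. pmf \<pi> x * f x)"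
  define v where "v = measure_pmf.variance \<pi> f"
  define c where "c = v / (4 * m)"
  define g where "g = (\<lambda>x. max (f x - c) 0)"
  define S where "S = {x. c < f x}"
  have v: "v = (\<Sum>x\<in>UNIV. pmf \<pi> x * (f x)\<^sup>2) - m\<^sup>2"
    unfolding v_def m_def by (rule variance_finite)
  have v0: "0 < v" using var by (simp add: v_def)
  have "m \<noteq> 0"
  proof
    assume "m = 0"
    then have "\<forall>x. pmf \<pi> x * f x = 0"
      unfolding m_def by (subst (asm) sum_nonneg_eq_0_iff) (auto simp: f0)
    then have "pmf \<pi> x * (f x)\<^sup>2 = 0" for x by auto
    then have "v = 0" using \<open>m = 0\<close> unfolding v by (simp only: sum.neutral_const) simp
    with v0 show False by simp
  qed
  moreover have "0 \<le> m" unfolding m_def by (intro sum_nonneg) (auto simp: f0)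
  ultimately have m0: "0 < m" by simp
  have c0: "0 < c" using v0 m0 by (simp add: c_def)
  have g0: "0 \<le> g x" and gf: "g x \<le> f x" for x using c0 f0[of x] by (auto simp: g_def)
  have gsq: "(f x)\<^sup>2 - 2 * c * f x \<le> (g x)\<^sup>2" for x
  proof (cases "c \<le> f x")
    case True
    then show ?thesis by (simp add: g_def power2_eq_square algebra_simps)
  next
    case False
    then have "f x * (f x - 2 * c) \<le> 0" using f0[of x] c0 by (intro mult_nonneg_nonpos) auto
    with False show ?thesis by (simp add: g_def power2_eq_square algebra_simps)
  qed
  have "2 * c * m = v / 2" using m0 by (simp add: c_def)
  then have "v / 2 = (\<Sum>x\<in>UNIV. pmf \<pi> x * (f x)\<^sup>2) - 2 * c * m - m\<^sup>2"
    using v by linarith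
  also have "(\<Sum>x\<in>UNIV. pmf \<pi> x * (f x)\<^sup>2) - 2 * c * m
      = (\<Sum>x\<in>UNIV. pmf \<pi> x * ((f x)\<^sup>2 - 2 * c * f x))"
    by (simp add: m_def algebra_simps sum_subtractf sum_distrib_left)
  also have "\<dots> \<le> (\<Sum>x\<in>UNIV. pmf \<pi> x * (g x)\<^sup>2)"
    by (intro sum_mono mult_left_mono gsq) auto
  also have "(\<Sum>x\<in>UNIV. pmf \<pi> x * (g x)\<^sup>2) - m\<^sup>2 \<le> measure_pmf.variance \<pi> g"
  proof -
    have "(\<Sum>x\<in>UNIV. pmf \<pi> x * g x)\<^sup>2 \<le> m\<^sup>2"
      unfolding m_def by (intro power_mono sum_mono mult_left_mono gf sum_nonneg) (auto simp: g0)
    then show ?thesis unfolding variance_finite by simp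
  qed
  finally have vg: "v / 2 \<le> measure_pmf.variance \<pi> g" by simp
  have nonconst: "\<not> g constant_on UNIV"
  proof
    assume "g constant_on UNIV"
    then obtain a where "g = (\<lambda>_. a)" by (auto simp: constant_on_def)
    then have "measure_pmf.variance \<pi> g = 0" by simp
    with vg v0 show False by simp
  qed
  have gS: "g \<in> c0_plus S" using g0 nonconst by (auto simp: c0_plus_def S_def g_def)
  have "S \<noteq> {}"
  proof
    assume "S = {}"
    then have "g = (\<lambda>_. 0)" by (auto simp: S_def g_def max_def not_less)
    with nonconst show False by (auto simp: constant_on_def)
  qed
  then obtain x where x: "x \<in> S" by auto
  have "min_prob \<pi> \<le> pmf \<pi> x" by (simp add: min_prob_def)
  also have "\<dots> \<le> measure_pmf.prob \<pi> S"
    unfolding prob_finite using x by (intro member_le_sum) auto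
  finally have S_lower: "min_prob \<pi> \<le> measure_pmf.prob \<pi> S" .
  have "c * measure_pmf.prob \<pi> S = (\<Sum>x\<in>S. pmf \<pi> x * c)"
    unfolding prob_finite by (simp add: sum_distrib_left mult.commute)
  also have "\<dots> \<le> (\<Sum>x\<in>S. pmf \<pi> x * f x)"
    by (intro sum_mono mult_left_mono) (auto simp: S_def)
  also have "\<dots> \<le> m" unfolding m_def by (intro sum_mono2) (auto simp: f0)
  finally have "measure_pmf.prob \<pi> S \<le> m / c" using c0 by (simp add: field_simps)
  also have "m / c = 4 * m\<^sup>2 / v" by (simp add: c_def power2_eq_square)
  finally have "spectral_profile K \<pi> (4 * m\<^sup>2 / v) \<le> set_eigenvalue K \<pi> S"
    unfolding spectral_profile_def using S_lower by (intro INF_lower) auto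
  also have "\<dots> \<le> ereal (dirichlet_form K \<pi> g g / measure_pmf.variance \<pi> g)"
    unfolding set_eigenvalue_def by (rule INF_lower[OF gS])
  also have "dirichlet_form K \<pi> g g / measure_pmf.variance \<pi> g \<le> dirichlet_form K \<pi> f f / (v / 2)"
    using dirichlet_form_truncation_le[OF inv, of f c] dirichlet_form_nonneg[OF inv] vg v0
    unfolding g_def by (intro frac_le) auto
  finally show ?thesis by (simp add: v_def m_def expectation_finite mult.commute)
qed

section \<open>Decay of the variance in one step\<close>

text \<open>Expand the variance around the value \<open>f y\<close> instead of the mean. The mean increment \<open>f x - f y\<close> is
  a sum over \<open>x \<noteq> y\<close> only, a set of mass \<open>1 - p(y)\<close>, so by Cauchy--Schwarz its square takes away at
  most the fraction \<open>1 - p(y)\<close> of the mean-square increment.\<close>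

lemma variance_ge_holding:
  fixes p :: "'a::finite pmf" and f :: "'a \<Rightarrow> real"
  shows "pmf p y * (\<Sum>x\<in>UNIV. pmf p x * (f x - f y)\<^sup>2) \<le> measure_pmf.variance p f"
proof -
  let ?B = "UNIV - {y}"
  define Q where "Q = (\<Sum>x\<in>UNIV. pmf p x * (f x - f y)\<^sup>2)"
  have rest: "(\<Sum>x\<in>?B. pmf p x) = 1 - pmf p y" by (simp add: sum_diff)
  have "(\<Sum>x\<in>UNIV. pmf p x * (f x - f y))\<^sup>2 = (\<Sum>x\<in>?B. pmf p x * (f x - f y))\<^sup>2"
    by (simp add: sum_diff)
  also have "\<dots> = (\<Sum>x\<in>?B. sqrt (pmf p x) * (sqrt (pmf p x) * (f x - f y)))\<^sup>2"
    by (simp flip: mult.assoc)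
  also have "\<dots> \<le> (\<Sum>x\<in>?B. (sqrt (pmf p x))\<^sup>2) * (\<Sum>x\<in>?B. (sqrt (pmf p x) * (f x - f y))\<^sup>2)"
    by (rule Cauchy_Schwarz_ineq_sum)
  also have "\<dots> = (1 - pmf p y) * Q"
    by (simp add: rest power_mult_distrib Q_def sum_diff)
  finally have "pmf p y * Q \<le> Q - (\<Sum>x\<in>UNIV. pmf p x * (f x - f y))\<^sup>2"
    by (simp add: algebra_simps)
  also have "(\<Sum>x\<in>UNIV. pmf p x * (f x - f y)) = (\<Sum>x\<in>UNIV. pmf p x * f x) - f y"
    by (simp add: right_diff_distrib sum_subtractf sum_distrib_right[symmetric])
  also have "Q - \<dots>\<^sup>2 = measure_pmf.variance p f"
    unfolding Q_def variance_finite sum_centred_square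
    by (simp add: power2_eq_square algebra_simps)
  finally show ?thesis by (simp add: Q_def)
qed

text \<open>The means of \<open>f\<close> and \<open>K f\<close> agree and \<open>\<pi>\<close> averages \<open>K(f\<^sup>2)\<close> to the second moment of \<open>f\<close>, so the
  loss of variance is the \<open>\<pi>\<close>-average of the variances of \<open>f\<close> under the distributions \<open>K(x, \<cdot>)\<close>.\<close>

lemma variance_kernel_operator_le:
  fixes K :: "'a::finite \<Rightarrow> 'a pmf"
  assumes inv: "invariant_pmf K \<pi>" and hold: "\<And>x. \<alpha> \<le> pmf (K x) x"
  shows "measure_pmf.variance \<pi> (kernel_operator K f)
    \<le> measure_pmf.variance \<pi> f - 2 * \<alpha> * dirichlet_form K \<pi> f f"
proof -
  define D where "D = (\<lambda>x. \<Sum>y\<in>UNIV. pmf (K x) y * (f y - f x)\<^sup>2)"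
  have D0: "0 \<le> D x" for x unfolding D_def by (intro sum_nonneg) auto
  have local: "\<alpha> * D x \<le> kernel_operator K (\<lambda>y. (f y)\<^sup>2) x - (kernel_operator K f x)\<^sup>2" for x
  proof -
    have "\<alpha> * D x \<le> pmf (K x) x * D x" by (intro mult_right_mono hold D0)
    also have "\<dots> \<le> measure_pmf.variance (K x) f"
      unfolding D_def by (rule variance_ge_holding)
    finally show ?thesis by (simp add: variance_finite kernel_operator_def)
  qed
  have "2 * \<alpha> * dirichlet_form K \<pi> f f = \<alpha> * (\<Sum>x\<in>UNIV. pmf \<pi> x * D x)"
    by (simp add: dirichlet_form_eq_sum_squares[OF inv] D_def)
  also have "\<dots> = (\<Sum>x\<in>UNIV. pmf \<pi> x * (\<alpha> * D x))"
    by (simp add: sum_distrib_left mult_ac)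
  also have "\<dots> \<le> (\<Sum>x\<in>UNIV. pmf \<pi> x *
      (kernel_operator K (\<lambda>y. (f y)\<^sup>2) x - (kernel_operator K f x)\<^sup>2))"
    by (intro sum_mono mult_left_mono local) auto
  also have "\<dots> = measure_pmf.variance \<pi> f - measure_pmf.variance \<pi> (kernel_operator K f)"
    by (simp add: variance_finite right_diff_distrib sum_subtractf
        invariant_pmf_sum_operator[OF inv])
  finally show ?thesis by simp
qed

section \<open>Decrease of the variance measured by the profile integral\<close>

lemma profile_integral_add:
  fixes K :: "'a::finite \<Rightarrow> 'a pmf"
  assumes "a \<le> b" "b \<le> c"
  shows "profile_integral K \<pi> \<alpha> a c = profile_integral K \<pi> \<alpha> a b + profile_integral K \<pi> \<alpha> b c"
proof -
  define G where "G = (\<lambda>v. e2ennreal (1 / (ereal (\<alpha> * v) * spectral_profile K \<pi> v)))"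
  have [measurable]: "G \<in> borel_measurable borel" unfolding G_def by measurable
  have G: "profile_integral K \<pi> \<alpha> s t = (\<integral>\<^sup>+v. G v * indicator {s..t} v \<partial>lborel)" for s t
    by (simp add: profile_integral_def G_def)
  have "profile_integral K \<pi> \<alpha> a c = (\<integral>\<^sup>+v. G v * indicator {a..b} v + G v * indicator {b..c} v \<partial>lborel)"
    unfolding G using AE_lborel_singleton[of b]
    by (intro nn_integral_cong_AE, eventually_elim) (use assms in \<open>auto simp: indicator_def\<close>)
  also have "\<dots> = profile_integral K \<pi> \<alpha> a b + profile_integral K \<pi> \<alpha> b c"
    unfolding G by (rule nn_integral_add) auto
  finally show ?thesis .
qed

lemma profile_integral_antimono_left:
  assumes "a \<le> b"
  shows "profile_integral K \<pi> \<alpha> b c \<le> profile_integral K \<pi> \<alpha> a c"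
  unfolding profile_integral_def using assms
  by (intro nn_integral_mono) (auto simp: indicator_def)

text \<open>On \<open>{a..b}\<close> the profile is at most its value at \<open>a\<close>, so the integrand is at least \<open>1 / (\<alpha> v l)\<close>.
  The bound \<open>l\<close> is separate from that value so that it can be taken arbitrarily small when the
  value is 0.\<close>

lemma profile_integral_ge_ln:
  fixes K :: "'a::finite \<Rightarrow> 'a pmf"
  assumes inv: "invariant_pmf K \<pi>" and \<alpha>: "0 < \<alpha>" and ab: "0 < a" "a \<le> b"
    and l: "0 < l" "spectral_profile K \<pi> a \<le> ereal l"
  shows "ennreal (ln (b / a) / (\<alpha> * l)) \<le> profile_integral K \<pi> \<alpha> a b"
proof -
  have "(\<integral>\<^sup>+v. ennreal (1 / (\<alpha> * v * l)) * indicator {a..b} v \<partial>lborel)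
      = ennreal (ln b / (\<alpha> * l) - ln a / (\<alpha> * l))"
  proof (rule nn_integral_FTC_Icc)
    show "DERIV (\<lambda>v. ln v / (\<alpha> * l)) v :> 1 / (\<alpha> * v * l)" if "v \<in> {a..b}" for v
      using that ab \<alpha> l
      by (auto intro!: derivative_eq_intros simp: field_simps)
  qed (use ab \<alpha> l in auto)
  also have "ln b / (\<alpha> * l) - ln a / (\<alpha> * l) = ln (b / a) / (\<alpha> * l)"
    using ab by (simp add: ln_div diff_divide_distrib)
  finally have "ennreal (ln (b / a) / (\<alpha> * l)) =
      (\<integral>\<^sup>+v. ennreal (1 / (\<alpha> * v * l)) * indicator {a..b} v \<partial>lborel)" by simp
  also have "\<dots> \<le> profile_integral K \<pi> \<alpha> a b"
    unfolding profile_integral_def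
  proof (intro nn_integral_mono)
    fix v
    show "ennreal (1 / (\<alpha> * v * l)) * indicator {a..b} v
      \<le> e2ennreal (1 / (ereal (\<alpha> * v) * spectral_profile K \<pi> v)) * indicator {a..b} v"
    proof (cases "v \<in> {a..b}")
      case True
      then have v: "0 < v" using ab by auto
      have le: "spectral_profile K \<pi> v \<le> ereal l"
        using spectral_profile_antimono[of a v K \<pi>] True l by (meson atLeastAtMost_iff order_trans)
      have ge: "0 \<le> spectral_profile K \<pi> v" by (rule spectral_profile_nonneg[OF inv])
      from le ge obtain s where s: "spectral_profile K \<pi> v = ereal s" "0 \<le> s" "s \<le> l"
        by (cases "spectral_profile K \<pi> v") auto
      have "ereal (1 / (\<alpha> * v * l)) \<le> 1 / (ereal (\<alpha> * v) * spectral_profile K \<pi> v)"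
      proof (cases "s = 0")
        case True
        then show ?thesis unfolding s by (simp add: divide_ereal_def)
      next
        case False
        then have "1 / (\<alpha> * v * l) \<le> 1 / (\<alpha> * v * s)" using s \<alpha> v by (intro frac_le) auto
        then show ?thesis using False \<alpha> v by (simp add: s one_ereal_def)
      qed
      then have "e2ennreal (ereal (1 / (\<alpha> * v * l)))
          \<le> e2ennreal (1 / (ereal (\<alpha> * v) * spectral_profile K \<pi> v))"
        by (rule e2ennreal_mono)
      then show ?thesis using True by simp
    qed simp
  qed
  finally show ?thesis .
qed

text \<open>The variances of the chain enter only as numbers \<open>V k\<close>. A step multiplies \<open>V k\<close> by at most
  \<open>1 - \<alpha> l k \<le> exp (- \<alpha> l k)\<close>, so \<open>ln (4 / V k)\<close> grows by at least \<open>\<alpha> l k\<close> and the integral by at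
  least 1. Strictness comes from the remaining interval between \<open>4 / V n\<close> and \<open>4 / \<epsilon>\<close>.\<close>

lemma profile_integral_gt_steps:
  fixes K :: "'a::finite \<Rightarrow> 'a pmf" and V l :: "nat \<Rightarrow> real"
  assumes inv: "invariant_pmf K \<pi>" and \<alpha>: "0 < \<alpha>" and \<epsilon>: "0 < \<epsilon>"
    and V: "\<And>k. k \<le> n \<Longrightarrow> \<epsilon> < V k"
    and l0: "\<And>k. k \<le> n \<Longrightarrow> 0 \<le> l k"
    and l: "\<And>k. k \<le> n \<Longrightarrow> spectral_profile K \<pi> (4 / V k) \<le> ereal (l k)"
    and step: "\<And>k. k < n \<Longrightarrow> V (Suc k) \<le> V k * (1 - \<alpha> * l k)"
  shows "of_nat n < profile_integral K \<pi> \<alpha> (4 / V 0) (4 / \<epsilon>)"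
proof -
  have V0: "0 < V k" if "k \<le> n" for k using V[OF that] \<epsilon> by simp
  have anti: "V (Suc k) \<le> V k" if "k < n" for k
  proof -
    have "V k * (1 - \<alpha> * l k) \<le> V k * 1"
      using that V0[of k] l0[of k] \<alpha> by (intro mult_left_mono) auto
    with step[OF that] show ?thesis by simp
  qed
  have V_le: "V k \<le> V 0" if "k \<le> n" for k
    using that
  proof (induction k)
    case (Suc k)
    then show ?case using anti[of k] by simp
  qed simp
  let ?I = "profile_integral K \<pi> \<alpha>"
  have tail: "?I (4 / V 0) (4 / \<epsilon>) = ?I (4 / V 0) (4 / V k) + ?I (4 / V k) (4 / \<epsilon>)"
    if "k \<le> n" for k
    using that V_le[of k] V0[of k] V[of k] \<epsilon> by (intro profile_integral_add frac_le) auto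
  show ?thesis
  proof (cases "\<exists>k\<le>n. l k = 0")
    case True
    then obtain k where k: "k \<le> n" "l k = 0" by auto
    \<comment> \<open>The profile vanishes from \<open>4 / V k\<close> on, so the integral is infinite; this choice of
      \<open>l'\<close> shows that it is at least \<open>n + 1\<close>.\<close>
    define l' where "l' = ln (V k / \<epsilon>) / (\<alpha> * (real n + 1))"
    have ln0: "0 < ln (V k / \<epsilon>)" using V[OF k(1)] \<epsilon> by (intro ln_gt_zero) simp
    have "0 < l'" unfolding l'_def using ln0 \<alpha> by (intro divide_pos_pos mult_pos_pos) auto
    have "of_nat n < (of_nat (Suc n) :: ennreal)"
      by (simp add: of_nat_Suc)
    also have "of_nat (Suc n) = ennreal (ln ((4 / \<epsilon>) / (4 / V k)) / (\<alpha> * l'))"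
      using ln0 \<alpha> \<epsilon> V0[OF k(1)] by (simp add: l'_def ennreal_of_nat_eq_real_of_nat add.commute)
    also have "\<dots> \<le> ?I (4 / V k) (4 / \<epsilon>)"
    proof (rule profile_integral_ge_ln[OF inv \<alpha> _ _ \<open>0 < l'\<close>])
      have "spectral_profile K \<pi> (4 / V k) \<le> ereal 0" using l[OF k(1)] k(2) by simp
      also have "\<dots> \<le> ereal l'" using \<open>0 < l'\<close> by simp
      finally show "spectral_profile K \<pi> (4 / V k) \<le> ereal l'" .
    qed (use V[OF k(1)] V0[OF k(1)] \<epsilon> in \<open>auto intro: frac_le\<close>)
    also have "\<dots> \<le> ?I (4 / V 0) (4 / \<epsilon>)" by (simp add: tail[OF k(1)])
    finally show ?thesis .
  next
    case False
    then have lpos: "0 < l k" if "k \<le> n" for k using that l0[OF that] by force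
    have clock: "of_nat k \<le> ?I (4 / V 0) (4 / V k)" if "k \<le> n" for k
      using that
    proof (induction k)
      case (Suc k)
      then have k: "k \<le> n" "k < n" "Suc k \<le> n" by auto
      have pos: "0 < 1 - \<alpha> * l k"
        using step[OF k(2)] V0[OF k(1)] V0[OF k(3)] by (smt (verit) mult_nonneg_nonpos)
      have "V (Suc k) / V k \<le> 1 - \<alpha> * l k"
        using step[OF k(2)] V0[OF k(1)] by (simp add: field_simps)
      then have "ln (V (Suc k) / V k) \<le> ln (1 - \<alpha> * l k)"
        using V0[OF k(1)] V0[OF k(3)] pos by simp
      also have "\<dots> \<le> - (\<alpha> * l k)" using ln_le_minus_one[OF pos] by simp
      finally have "\<alpha> * l k \<le> ln ((4 / V (Suc k)) / (4 / V k))"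
        using V0[OF k(1)] V0[OF k(3)] by (simp add: ln_div)
      then have "1 \<le> ln ((4 / V (Suc k)) / (4 / V k)) / (\<alpha> * l k)"
        using \<alpha> lpos[OF k(1)] by simp
      then have "1 \<le> ennreal (ln ((4 / V (Suc k)) / (4 / V k)) / (\<alpha> * l k))"
        by (metis ennreal_1 ennreal_leI)
      also have "\<dots> \<le> ?I (4 / V k) (4 / V (Suc k))"
        using V0[OF k(1)] V0[OF k(3)] anti[OF k(2)]
        by (intro profile_integral_ge_ln inv \<alpha> lpos[OF k(1)] l[OF k(1)] frac_le) auto
      finally have "of_nat k + 1 \<le> ?I (4 / V 0) (4 / V k) + ?I (4 / V k) (4 / V (Suc k))"
        using Suc.IH[OF k(1)] by (intro add_mono)
      also have "\<dots> = ?I (4 / V 0) (4 / V (Suc k))"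
        using V0[OF k(1)] V0[OF k(3)] anti[OF k(2)] V_le[OF k(1)]
        by (intro profile_integral_add[symmetric] frac_le) auto
      finally show ?case by (simp add: add.commute)
    qed simp
    have "0 < ln ((4 / \<epsilon>) / (4 / V n)) / (\<alpha> * l n)"
      using V[of n] V0[of n] \<epsilon> \<alpha> lpos[of n]
      by (intro divide_pos_pos mult_pos_pos ln_gt_zero) (auto simp: field_simps)
    then have "0 < ennreal (ln ((4 / \<epsilon>) / (4 / V n)) / (\<alpha> * l n))"
      by (simp only: ennreal_less_zero_iff)
    also have "\<dots> \<le> ?I (4 / V n) (4 / \<epsilon>)"
      using V[of n] V0[of n] \<epsilon>
      by (intro profile_integral_ge_ln inv \<alpha> lpos[of n] l[of n] frac_le) auto
    finally have rest: "0 < ?I (4 / V n) (4 / \<epsilon>)" .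
    have "of_nat n < (of_nat n :: ennreal) + ?I (4 / V n) (4 / \<epsilon>)"
      using rest ennreal_add_left_cancel_less[of "of_nat n" 0] by simp
    also have "\<dots> \<le> ?I (4 / V 0) (4 / \<epsilon>)"
      unfolding tail[OF order_refl] by (intro add_right_mono clock) simp
    finally show ?thesis .
  qed
qed

section \<open>Powers of the kernel and the reversed kernel\<close>

lemma pmf_kernel_power_Suc:
  fixes K :: "'a::finite \<Rightarrow> 'a pmf"
  shows "pmf (kernel_power K (Suc n) x) y = (\<Sum>z\<in>UNIV. pmf (K x) z * pmf (kernel_power K n z) y)"
  by (simp add: pmf_bind expectation_finite)

lemma kernel_power_add:
  "kernel_power K (m + n) x = bind_pmf (kernel_power K m x) (kernel_power K n)"
  by (induction m arbitrary: x) (auto simp: bind_return_pmf bind_assoc_pmf intro!: bind_pmf_cong)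

lemma invariant_pmf_kernel_power:
  assumes "invariant_pmf K \<pi>"
  shows "invariant_pmf (kernel_power K n) \<pi>"
proof (induction n)
  case 0
  show ?case by (simp add: invariant_pmf_def bind_return_pmf')
next
  case (Suc n)
  have "bind_pmf \<pi> (kernel_power K (Suc n)) = bind_pmf (bind_pmf \<pi> K) (kernel_power K n)"
    unfolding bind_assoc_pmf by (intro bind_pmf_cong) auto
  also have "\<dots> = \<pi>" using Suc assms by (simp add: invariant_pmf_def)
  finally show ?case unfolding invariant_pmf_def .
qed

text \<open>Some state carries mass, and by irreducibility some power of the kernel, which preserves \<open>\<pi>\<close>, moves
  part of that mass to \<open>y\<close>.\<close>

lemma irreducible_invariant_pmf_pos:
  assumes irr: "irreducible_kernel K" and inv: "invariant_pmf K \<pi>"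
  shows "0 < pmf \<pi> y"
proof -
  obtain x where x: "x \<in> set_pmf \<pi>" using set_pmf_not_empty[of \<pi>] by auto
  obtain n where "0 < pmf (kernel_power K n x) y" using irr by (auto simp: irreducible_kernel_def)
  then have "y \<in> set_pmf (kernel_power K n x)" by (simp add: set_pmf_iff)
  with x have "y \<in> set_pmf (bind_pmf \<pi> (kernel_power K n))" by auto
  also have "bind_pmf \<pi> (kernel_power K n) = \<pi>"
    using invariant_pmf_kernel_power[OF inv] by (simp add: invariant_pmf_def)
  finally show ?thesis by (rule pmf_positive)
qed

text \<open>The weights form a probability distribution when \<open>\<pi>\<close> is invariant under \<open>K\<close> and charges every
  state.\<close>

definition reversed_kernel :: "('a::finite \<Rightarrow> 'a pmf) \<Rightarrow> 'a pmf \<Rightarrow> 'a \<Rightarrow> 'a pmf" where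
  "reversed_kernel K \<pi> x = embed_pmf (\<lambda>y. pmf \<pi> y * pmf (K y) x / pmf \<pi> x)"

context
  fixes K :: "'a::finite \<Rightarrow> 'a pmf" and \<pi> :: "'a pmf"
  assumes inv: "invariant_pmf K \<pi>" and pos: "\<And>x. 0 < pmf \<pi> x"
begin

lemma pmf_reversed_kernel:
  "pmf (reversed_kernel K \<pi> x) y = pmf \<pi> y * pmf (K y) x / pmf \<pi> x"
  unfolding reversed_kernel_def
proof (rule pmf_embed_pmf)
  show "0 \<le> pmf \<pi> y * pmf (K y) x / pmf \<pi> x" for y by simp
  have "(\<Sum>y\<in>UNIV. pmf \<pi> y * pmf (K y) x / pmf \<pi> x) = 1"
    using pos[of x] by (simp add: sum_divide_distrib[symmetric] invariant_pmf_sum[OF inv])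
  then show "(\<integral>\<^sup>+y. ennreal (pmf \<pi> y * pmf (K y) x / pmf \<pi> x) \<partial>count_space UNIV) = 1"
    by (subst nn_integral_count_space_finite) (auto simp: sum_ennreal)
qed

lemma invariant_reversed_kernel: "invariant_pmf (reversed_kernel K \<pi>) \<pi>"
proof -
  have "pmf \<pi> x * pmf (reversed_kernel K \<pi> x) y = pmf \<pi> y * pmf (K y) x" for x y
    using pos[of x] by (simp add: pmf_reversed_kernel)
  then show ?thesis
    unfolding invariant_pmf_def
    by (intro pmf_eqI) (simp add: pmf_bind expectation_finite sum_distrib_left[symmetric])
qed

lemma dirichlet_form_reversed_kernel:
  "dirichlet_form (reversed_kernel K \<pi>) \<pi> f f = dirichlet_form K \<pi> f f"
proof -
  have "(\<Sum>x\<in>UNIV. pmf \<pi> x * (\<Sum>y\<in>UNIV. pmf (reversed_kernel K \<pi> x) y * (f y - f x)\<^sup>2))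
      = (\<Sum>x\<in>UNIV. \<Sum>y\<in>UNIV. pmf \<pi> y * (pmf (K y) x * (f x - f y)\<^sup>2))"
    unfolding sum_distrib_left using pos
    by (intro sum.cong refl) (simp add: pmf_reversed_kernel power2_commute less_imp_neq[THEN not_sym])
  also have "\<dots> = (\<Sum>y\<in>UNIV. pmf \<pi> y * (\<Sum>x\<in>UNIV. pmf (K y) x * (f x - f y)\<^sup>2))"
    unfolding sum_distrib_left by (rule sum.swap)
  finally show ?thesis
    by (simp add: dirichlet_form_eq_sum_squares[OF inv]
        dirichlet_form_eq_sum_squares[OF invariant_reversed_kernel])
qed

lemma profile_integral_reversed_kernel:
  "profile_integral (reversed_kernel K \<pi>) \<pi> = profile_integral K \<pi>"
  unfolding profile_integral_def spectral_profile_def set_eigenvalue_def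
  by (simp only: dirichlet_form_reversed_kernel)

text \<open>The first step of the reversed chain is the last step of the original one, so the induction peels
  off opposite ends of the path on the two sides.\<close>

lemma pmf_kernel_power_reversed:
  "pmf \<pi> x * pmf (kernel_power (reversed_kernel K \<pi>) n x) y = pmf \<pi> y * pmf (kernel_power K n y) x"
proof (induction n arbitrary: x y)
  case 0
  show ?case by (simp add: indicator_def)
next
  case (Suc n)
  have "pmf \<pi> x * pmf (kernel_power (reversed_kernel K \<pi>) (Suc n) x) y
      = (\<Sum>z\<in>UNIV. pmf (K z) x * (pmf \<pi> z * pmf (kernel_power (reversed_kernel K \<pi>) n z) y))"
    unfolding pmf_kernel_power_Suc sum_distrib_left using pos[of x]
    by (intro sum.cong refl) (simp add: pmf_reversed_kernel)
  also have "\<dots> = pmf \<pi> y * (\<Sum>z\<in>UNIV. pmf (kernel_power K n y) z * pmf (K z) x)"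
    unfolding Suc by (simp add: sum_distrib_left mult_ac)
  also have "\<dots> = pmf \<pi> y * pmf (bind_pmf (kernel_power K n y) K) x"
    unfolding pmf_bind expectation_finite ..
  also have "bind_pmf (kernel_power K n y) K = kernel_power K (Suc n) y"
  proof -
    have "kernel_power K 1 = K" by (intro ext) (simp add: bind_return_pmf' cong: bind_pmf_cong)
    then show ?thesis using kernel_power_add[of K n 1 y] by simp
  qed
  finally show ?case .
qed

end

section \<open>From the mean-square distance to the uniform distance\<close>

text \<open>If the variance were still above \<open>\<epsilon>\<close> after \<open>n\<close> steps, it would have been so all along, and the
  integral would exceed \<open>n\<close>. The lower limit of integration comes from the initial variance
  \<open>1 / \<pi>(y) - 1\<close>.\<close>

lemma kernel_power_mean_square_le:
  fixes K :: "'a::finite \<Rightarrow> 'a pmf"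
  assumes inv: "invariant_pmf K \<pi>" and pos: "\<And>x. 0 < pmf \<pi> x"
    and \<alpha>: "0 < \<alpha>" and hold: "\<And>x. \<alpha> \<le> pmf (K x) x" and \<epsilon>: "0 < \<epsilon>"
    and n: "profile_integral K \<pi> \<alpha> (4 * min_prob \<pi>) (4 / \<epsilon>) \<le> of_nat n"
  shows "(\<Sum>z\<in>UNIV. pmf \<pi> z * (pmf (kernel_power K n z) y / pmf \<pi> y - 1)\<^sup>2) \<le> \<epsilon>"
proof -
  define h where "h = (\<lambda>n z. pmf (kernel_power K n z) y / pmf \<pi> y)"
  define V where "V = (\<lambda>k. measure_pmf.variance \<pi> (h k))"
  define l where "l = (\<lambda>k. 2 * dirichlet_form K \<pi> (h k) (h k) / V k)"
  have h_mean: "measure_pmf.expectation \<pi> (h k) = 1" for k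
    using invariant_pmf_sum[OF invariant_pmf_kernel_power[OF inv], of k y] pos[of y]
    by (simp add: expectation_finite h_def sum_divide_distrib[symmetric])
  have h_Suc: "h (Suc k) = kernel_operator K (h k)" for k
    unfolding h_def pmf_kernel_power_Suc kernel_operator_def by (simp add: sum_divide_distrib)
  have V_Suc: "V (Suc k) \<le> V k - 2 * \<alpha> * dirichlet_form K \<pi> (h k) (h k)" for k
    unfolding V_def h_Suc by (rule variance_kernel_operator_le[OF inv hold])
  have V_anti: "V (Suc k) \<le> V k" for k
    using V_Suc[of k] \<alpha> dirichlet_form_nonneg[OF inv, of "h k"]
    by (smt (verit) mult_nonneg_nonneg)
  have "V n \<le> \<epsilon>"
  proof (rule ccontr)
    assume "\<not> V n \<le> \<epsilon>"
    then have V: "\<epsilon> < V k" if "k \<le> n" for k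
      using lift_Suc_antimono_le[of V, OF V_anti that] by simp
    have V0: "0 < V k" if "k \<le> n" for k using V[OF that] \<epsilon> by simp
    have "of_nat n < profile_integral K \<pi> \<alpha> (4 / V 0) (4 / \<epsilon>)"
    proof (rule profile_integral_gt_steps[OF inv \<alpha> \<epsilon> V, where l = l])
      fix k assume k: "k \<le> n"
      show "0 \<le> l k" using V0[OF k] dirichlet_form_nonneg[OF inv, of "h k"] by (simp add: l_def)
      show "spectral_profile K \<pi> (4 / V k) \<le> ereal (l k)"
        using spectral_profile_le_dirichlet_form[OF inv, of "h k"] V0[OF k]
        unfolding h_mean l_def V_def by (simp add: h_def)
    next
      fix k assume "k < n"
      then show "V (Suc k) \<le> V k * (1 - \<alpha> * l k)"
        using V_Suc[of k] V0[of k] by (simp add: l_def algebra_simps)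
    qed
    also have "\<dots> \<le> profile_integral K \<pi> \<alpha> (4 * min_prob \<pi>) (4 / \<epsilon>)"
    proof (rule profile_integral_antimono_left)
      have "V 0 = (\<Sum>x\<in>UNIV. pmf \<pi> x * (h 0 x)\<^sup>2) - 1"
        using variance_finite[of \<pi> "h 0"] h_mean[of 0]
        unfolding V_def expectation_finite[of \<pi> "h 0"] by simp
      also have "(\<Sum>x\<in>UNIV. pmf \<pi> x * (h 0 x)\<^sup>2) = (\<Sum>x\<in>UNIV. if x = y then 1 / pmf \<pi> y else 0)"
        using pos[of y] by (intro sum.cong) (auto simp: h_def power2_eq_square)
      finally have "V 0 < 1 / pmf \<pi> y" by simp
      then have "V 0 * pmf \<pi> y \<le> 1" using pos[of y] by (simp add: field_simps)
      have "V 0 * min_prob \<pi> \<le> V 0 * pmf \<pi> y"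
        using V0[of 0] by (intro mult_left_mono) (auto simp: min_prob_def)
      also note \<open>V 0 * pmf \<pi> y \<le> 1\<close>
      finally show "4 * min_prob \<pi> \<le> 4 / V 0"
        using V0[of 0] by (simp add: field_simps)
    qed
    also note n
    finally show False by simp
  qed
  then show ?thesis unfolding V_def h_mean by (simp add: expectation_finite h_def)
qed

text \<open>With \<open>f\<close> the density \<open>K\<^sub>n(x, \<cdot>) / \<pi>\<close> of the first half of the path, which is the function \<open>h\<^sub>n\<close> of
  the reversed chain with target \<open>x\<close>, and \<open>g = K\<^sub>n(\<cdot>, y) / \<pi>(y)\<close> that of the second half,
  \<open>K\<^sub>2\<^sub>n(x, y) / \<pi>(y) - 1\<close> is the inner product of \<open>f - 1\<close> and \<open>g - 1\<close> in \<open>L\<^sup>2(\<pi>)\<close>.\<close>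

lemma kernel_power_uniform_le:
  fixes K :: "'a::finite \<Rightarrow> 'a pmf"
  assumes inv: "invariant_pmf K \<pi>" and pos: "\<And>x. 0 < pmf \<pi> x"
    and \<alpha>: "0 < \<alpha>" and hold: "\<And>x. \<alpha> \<le> pmf (K x) x" and \<epsilon>: "0 < \<epsilon>"
    and n: "profile_integral K \<pi> \<alpha> (4 * min_prob \<pi>) (4 / \<epsilon>) \<le> of_nat n"
  shows "\<bar>pmf (kernel_power K (2 * n) x) y / pmf \<pi> y - 1\<bar> \<le> \<epsilon>"
proof -
  let ?R = "reversed_kernel K \<pi>"
  define f where "f = (\<lambda>z. pmf (kernel_power ?R n z) x / pmf \<pi> x)"
  define g where "g = (\<lambda>z. pmf (kernel_power K n z) y / pmf \<pi> y)"
  have f: "(\<Sum>z\<in>UNIV. pmf \<pi> z * (f z - 1)\<^sup>2) \<le> \<epsilon>"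
    unfolding f_def
  proof (rule kernel_power_mean_square_le[OF invariant_reversed_kernel[OF inv pos] pos \<alpha> _ \<epsilon>])
    show "\<alpha> \<le> pmf (?R z) z" for z
      using hold[of z] pos[of z] by (simp add: pmf_reversed_kernel[OF inv pos])
    show "profile_integral ?R \<pi> \<alpha> (4 * min_prob \<pi>) (4 / \<epsilon>) \<le> of_nat n"
      unfolding profile_integral_reversed_kernel[OF inv pos] by (rule n)
  qed
  have g: "(\<Sum>z\<in>UNIV. pmf \<pi> z * (g z - 1)\<^sup>2) \<le> \<epsilon>"
    unfolding g_def by (rule kernel_power_mean_square_le[OF inv pos \<alpha> hold \<epsilon> n])
  have fK: "pmf \<pi> z * f z = pmf (kernel_power K n x) z" for z
    using pmf_kernel_power_reversed[OF inv pos, of z n x] pos[of x] by (simp add: f_def)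
  have mean_f: "(\<Sum>z\<in>UNIV. pmf \<pi> z * f z) = 1" unfolding fK by simp
  have mean_g: "(\<Sum>z\<in>UNIV. pmf \<pi> z * g z) = 1"
    using invariant_pmf_sum[OF invariant_pmf_kernel_power[OF inv], of n y] pos[of y]
    by (simp add: g_def sum_divide_distrib[symmetric])
  have "pmf (kernel_power K (2 * n) x) y / pmf \<pi> y = (\<Sum>z\<in>UNIV. pmf \<pi> z * f z * g z)"
    unfolding mult_2 kernel_power_add fK
    by (simp add: pmf_bind expectation_finite g_def sum_divide_distrib)
  then have "pmf (kernel_power K (2 * n) x) y / pmf \<pi> y - 1
      = (\<Sum>z\<in>UNIV. pmf \<pi> z * f z * g z) - (\<Sum>z\<in>UNIV. pmf \<pi> z * f z)
      - (\<Sum>z\<in>UNIV. pmf \<pi> z * g z) + (\<Sum>z\<in>UNIV. pmf \<pi> z)"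
    by (simp add: mean_f mean_g)
  also have "\<dots> = (\<Sum>z\<in>UNIV. pmf \<pi> z * f z * g z - pmf \<pi> z * f z - pmf \<pi> z * g z + pmf \<pi> z)"
    by (simp only: sum.distrib sum_subtractf)
  also have "\<dots> = (\<Sum>z\<in>UNIV. (sqrt (pmf \<pi> z) * (f z - 1)) * (sqrt (pmf \<pi> z) * (g z - 1)))"
  proof (intro sum.cong refl)
    fix z
    have "(sqrt (pmf \<pi> z) * (f z - 1)) * (sqrt (pmf \<pi> z) * (g z - 1))
        = (sqrt (pmf \<pi> z) * sqrt (pmf \<pi> z)) * ((f z - 1) * (g z - 1))" by (simp only: mult_ac)
    also have "\<dots> = pmf \<pi> z * ((f z - 1) * (g z - 1))" by simp
    finally show "pmf \<pi> z * f z * g z - pmf \<pi> z * f z - pmf \<pi> z * g z + pmf \<pi> z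
        = (sqrt (pmf \<pi> z) * (f z - 1)) * (sqrt (pmf \<pi> z) * (g z - 1))"
      by (simp add: algebra_simps)
  qed
  finally have "(pmf (kernel_power K (2 * n) x) y / pmf \<pi> y - 1)\<^sup>2
      \<le> (\<Sum>z\<in>UNIV. (sqrt (pmf \<pi> z) * (f z - 1))\<^sup>2) * (\<Sum>z\<in>UNIV. (sqrt (pmf \<pi> z) * (g z - 1))\<^sup>2)"
    by (simp only: Cauchy_Schwarz_ineq_sum)
  also have "\<dots> \<le> \<epsilon> * \<epsilon>"
    using f g \<epsilon> by (intro mult_mono) (auto simp: power_mult_distrib intro!: sum_nonneg)
  finally show ?thesis
    using \<epsilon> by (intro abs_le_square_iff[THEN iffD2, of _ \<epsilon>, simplified abs_of_pos[OF \<epsilon>]])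
      (simp add: power2_eq_square)
qed

theorem corollary2p1:
  fixes K :: "'a::finite \<Rightarrow> 'a pmf" and \<pi> :: "'a pmf" and \<alpha> \<epsilon> :: real
  assumes "irreducible_kernel K"
    and "invariant_pmf K \<pi>"
    and "\<alpha> > 0"
    and "\<And>x. pmf (K x) x \<ge> \<alpha>"
    and "\<epsilon> > 0"
  shows "mixing_time_Linf K \<pi> \<epsilon>
           \<le> 2 * ennreal_ceiling (profile_integral K \<pi> \<alpha> (4 * min_prob \<pi>) (4 / \<epsilon>))"
proof -
  define I where "I = profile_integral K \<pi> \<alpha> (4 * min_prob \<pi>) (4 / \<epsilon>)"
  show ?thesis
  proof (cases "I = \<infinity>")
    case True
    then show ?thesis by (simp add: I_def ennreal_ceiling_def numeral_eq_enat)
  next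
    case False
    define n where "n = nat \<lceil>enn2real I\<rceil>"
    have "I = ennreal (enn2real I)" using False by (simp add: top.not_eq_extremum)
    also have "\<dots> \<le> ennreal (real n)" unfolding n_def by (intro ennreal_leI) linarith
    finally have "I \<le> of_nat n" by (simp add: ennreal_of_nat_eq_real_of_nat)
    then have "(SUP (x, y)\<in>UNIV. \<bar>pmf (kernel_power K (2 * n) x) y / pmf \<pi> y - 1\<bar>) \<le> \<epsilon>"
      using kernel_power_uniform_le[OF assms(2) irreducible_invariant_pmf_pos[OF assms(1,2)]
          assms(3,4,5), of n]
      by (intro cSUP_least) (auto simp: I_def)
    then have "mixing_time_Linf K \<pi> \<epsilon> \<le> enat (2 * n)"
      unfolding mixing_time_Linf_def by (intro INF_lower) simp
    also have "enat (2 * n) = 2 * ennreal_ceiling I"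
      using False by (simp add: ennreal_ceiling_def n_def numeral_eq_enat)
    finally show ?thesis by (simp add: I_def)
  qed
qed

end
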